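(* Let $X$ be a free Poisson random measure (with $\alpha=1$) in a $W^*$-probability space $(\mathcal{A},\varphi)$, and let $f\in L^1(\mathbb{R})\cap L^2(\mathbb{R})$ be a real-valued function. Then $X(f)=\lim_{t\to\infty}X(f,t)$ exists, where the limit is taken in the norm $\|\cdot\|_2$ of $L^2(\mathcal{A},\varphi)$ and $X(f,t)=\int_{-t}^{t}f(x)\,X(dx)$.
   Context: A $W^*$-probability space $(\mathcal{A},\varphi)$ is a finite von Neumann algebra with a faithful normal tracial state; $\|a\|_p=\varphi(|a|^p)^{1/p}$ and $L^p(\mathcal{A},\varphi)$ is the completion of $\mathcal{A}$ in $\|\cdot\|_p$, $p\ge1$. $\kappa_n(a):=\kappa_n(a,\dots,a)$ denotes the usual $n$-th free cumulant. Free Poisson random measure (with $\alpha=1$): a map $E\mapsto X_E$ from the set $\mathcal{B}_0$ of Borel subsets of $\mathbb{R}$ of finite Lebesgue measure $|E|$ into the self-adjoint elements of $\mathcal{A}$ such that (1) $\kappa_n(X_E)=|E|$ for all $n\ge1$; (2) if $E_1,\dots,E_k$ are mutually disjoint, then $X_{E_1},\dots,X_{E_k}$ are freely independent; (3) if $E_1,\dots,E_k$ are mutually disjoint, then $X_{\cup_{i=1}^kE_i}=\sum_{i=1}^kX_{E_i}$. Integral: for a simple function $s=\sum_{i=1}^nc_i\chi_{E_i}$ with $E_i\in\mathcal{B}_0$ mutually disjoint, $X(s)=\sum_{i=1}^nc_iX_{E_i}$. For $f\in L^2(\mathbb{R})$ whose support $S_f$ has finite measure, $X(f)=\int_{\mathbb{R}}f(x)X(dx)$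 is the $\|\cdot\|_2$-limit of $X(s_n)$ for any sequence of simple functions $s_n$ supported in $S_f$ with $\|s_n-f\|_2\to0$ (it exists and does not depend on the sequence). For $f\in L^2(\mathbb{R})$ and $t\ge0$, $X(f,t)=\int_{-t}^tf(x)X(dx):=X(f\chi_{[-t,t]})$. *)

theory Defs
  imports "HOL-Analysis.Analysis"
begin

section \<open>Complex Hilbert spaces and their bounded operators\<close>

text \<open>
  The inner product is linear in its first argument. The real Hilbert space structure
  (with inner product the real part) is inherited, so that norm, topology and the space
  of bounded real-linear maps are those of the library.
\<close>

class complex_hilbert = real_inner + complete_space +
  fixes scaleC :: "complex \<Rightarrow> 'a \<Rightarrow> 'a"  (infixr "*\<^sub>C" 75)
    and cinner :: "'a \<Rightarrow> 'a \<Rightarrow> complex"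
  assumes scaleC_add_right: "c *\<^sub>C (x + y) = c *\<^sub>C x + c *\<^sub>C y"
    and scaleC_add_left: "(c + d) *\<^sub>C x = c *\<^sub>C x + d *\<^sub>C x"
    and scaleC_scaleC: "c *\<^sub>C (d *\<^sub>C x) = (c * d) *\<^sub>C x"
    and scaleC_of_real: "complex_of_real r *\<^sub>C x = r *\<^sub>R x"
    and cinner_commute: "cinner y x = cnj (cinner x y)"
    and cinner_add_left: "cinner (x + y) z = cinner x z + cinner y z"
    and cinner_scaleC_left: "cinner (c *\<^sub>C x) y = c * cinner x y"
    and inner_eq_Re_cinner: "inner x y = Re (cinner x y)"

type_synonym 'h oper = "'h \<Rightarrow>\<^sub>L 'h"

definition cscale :: "complex \<Rightarrow> 'h::complex_hilbert oper \<Rightarrow> 'h oper"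
  where "cscale c T = Blinfun (\<lambda>x. c *\<^sub>C blinfun_apply T x)"

lemma norm_scaleC: "norm (c *\<^sub>C x) = cmod c * norm (x::'a::complex_hilbert)"
proof -
  have real: "cnj (cinner x x) = cinner x x"
    using cinner_commute[of x x] by simp
  have "cinner (c *\<^sub>C x) (c *\<^sub>C x) = c * cnj (c * cinner x x)"
    by (simp only: cinner_scaleC_left cinner_commute[where x = "c *\<^sub>C x" and y = x])
  also have "\<dots> = (c * cnj c) * cnj (cinner x x)"
    by simp
  also have "\<dots> = complex_of_real ((cmod c)\<^sup>2) * cinner x x"
    by (simp only: complex_norm_square real)
  finally have "inner (c *\<^sub>C x) (c *\<^sub>C x) = (cmod c)\<^sup>2 * inner x x"
    by (simp add: inner_eq_Re_cinner)
  then show ?thesis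
    by (simp add: norm_eq_sqrt_inner real_sqrt_mult)
qed

lemma bounded_linear_scaleC: "bounded_linear (\<lambda>x. c *\<^sub>C (x::'a::complex_hilbert))"
proof (rule bounded_linear_intro[where K = "cmod c"])
  show "c *\<^sub>C (r *\<^sub>R x) = r *\<^sub>R (c *\<^sub>C x)" for r and x :: 'a
    by (simp only: scaleC_scaleC scaleC_of_real[symmetric] mult.commute)
qed (simp_all add: scaleC_add_right norm_scaleC mult.commute)

lemma cscale_apply: "blinfun_apply (cscale c T) x = c *\<^sub>C blinfun_apply T x"
  by (simp add: cscale_def bounded_linear_Blinfun_apply
      bounded_linear_compose[OF bounded_linear_scaleC blinfun.bounded_linear_right])

definition bounded_operators :: "'h::complex_hilbert oper set"
  where "bounded_operators = {T. \<forall>c x. blinfun_apply T (c *\<^sub>C x) = c *\<^sub>C blinfun_apply T x}"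

definition adj :: "'h::complex_hilbert oper \<Rightarrow> 'h oper"
  where "adj T = (THE S. \<forall>x y. cinner (blinfun_apply T x) y = cinner x (blinfun_apply S y))"

definition self_adjoint :: "'h::complex_hilbert oper \<Rightarrow> bool"
  where "self_adjoint T \<longleftrightarrow>
    (\<forall>x y. cinner (blinfun_apply T x) y = cinner x (blinfun_apply T y))"

definition positive_oper :: "'h::complex_hilbert oper \<Rightarrow> bool"
  where "positive_oper T \<longleftrightarrow> (\<forall>x. cinner (blinfun_apply T x) x \<in> \<real>\<^sub>\<ge>\<^sub>0)"

definition oper_le :: "'h::complex_hilbert oper \<Rightarrow> 'h oper \<Rightarrow> bool"
  where "oper_le S T \<longleftrightarrow> positive_oper (T - S)"


section \<open>Finite von Neumann algebras with a faithful normal tracial state\<close>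

definition commutant :: "'h::complex_hilbert oper set \<Rightarrow> 'h oper set"
  where "commutant S = {T \<in> bounded_operators. \<forall>a\<in>S. T o\<^sub>L a = a o\<^sub>L T}"

definition von_neumann_algebra :: "'h::complex_hilbert oper set \<Rightarrow> bool"
  where "von_neumann_algebra M \<longleftrightarrow>
    M \<subseteq> bounded_operators \<and> (\<forall>a\<in>M. adj a \<in> M) \<and> commutant (commutant M) = M"

definition finite_von_neumann_algebra :: "'h::complex_hilbert oper set \<Rightarrow> bool"
  where "finite_von_neumann_algebra M \<longleftrightarrow>
    von_neumann_algebra M \<and>
    (\<forall>v\<in>M. adj v o\<^sub>L v = id_blinfun \<longrightarrow> v o\<^sub>L adj v = id_blinfun)"

definition oper_lub :: "'h::complex_hilbert oper set \<Rightarrow> 'h oper set \<Rightarrow> 'h oper \<Rightarrow> bool"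
  where "oper_lub M D s \<longleftrightarrow>
    s \<in> M \<and> self_adjoint s \<and> (\<forall>d\<in>D. oper_le d s) \<and>
    (\<forall>u\<in>M. self_adjoint u \<and> (\<forall>d\<in>D. oper_le d u) \<longrightarrow> oper_le s u)"

definition normal_on :: "'h::complex_hilbert oper set \<Rightarrow> ('h oper \<Rightarrow> complex) \<Rightarrow> bool"
  where "normal_on M \<phi> \<longleftrightarrow>
    (\<forall>D s. D \<subseteq> {a \<in> M. positive_oper a} \<longrightarrow> D \<noteq> {} \<longrightarrow>
       (\<forall>a\<in>D. \<forall>b\<in>D. \<exists>c\<in>D. oper_le a c \<and> oper_le b c) \<longrightarrow>
       oper_lub M D s \<longrightarrow>
       bdd_above ((\<lambda>d. Re (\<phi> d)) ` D) \<and> Re (\<phi> s) = (SUP d\<in>D. Re (\<phi> d)))"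

locale w_star_probability_space =
  fixes M :: "'h::complex_hilbert oper set"
    and \<phi> :: "'h oper \<Rightarrow> complex"
  assumes finite_vna: "finite_von_neumann_algebra M"
    and state_add: "\<And>a b. a \<in> M \<Longrightarrow> b \<in> M \<Longrightarrow> \<phi> (a + b) = \<phi> a + \<phi> b"
    and state_cscale: "\<And>c a. a \<in> M \<Longrightarrow> \<phi> (cscale c a) = c * \<phi> a"
    and state_unit: "\<phi> id_blinfun = 1"
    and state_positive: "\<And>a. a \<in> M \<Longrightarrow> \<phi> (adj a o\<^sub>L a) \<in> \<real>\<^sub>\<ge>\<^sub>0"
    and state_faithful: "\<And>a. a \<in> M \<Longrightarrow> \<phi> (adj a o\<^sub>L a) = 0 \<Longrightarrow> a = 0"
    and state_tracial: "\<And>a b. a \<in> M \<Longrightarrow> b \<in> M \<Longrightarrow> \<phi> (a o\<^sub>L b) = \<phi> (b o\<^sub>L a)"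
    and state_normal: "normal_on M \<phi>"

text \<open>For exponent 2, the operator whose trace is taken is the square of the absolute value of
  \<open>a\<close>, that is, the product of the adjoint of \<open>a\<close> with \<open>a\<close>.\<close>

definition norm2 :: "('h::complex_hilbert oper \<Rightarrow> complex) \<Rightarrow> 'h oper \<Rightarrow> real"
  where "norm2 \<phi> a = sqrt (Re (\<phi> (adj a o\<^sub>L a)))"

text \<open>
  The completion of \<open>M\<close> in this norm, given by a linear isometry \<open>\<iota>\<close> of \<open>M\<close> into a
  complete space, in which the completion \<open>L\<close> is the closure of the image. It is a set rather
  than a type because it depends on \<open>M\<close> and \<open>\<phi>\<close>; it is unique up to isometric isomorphism over \<open>M\<close>.
\<close>

definition is_L2_completion ::
  "'h::complex_hilbert oper set \<Rightarrow> ('h oper \<Rightarrow> complex) \<Rightarrow>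
    ('h oper \<Rightarrow> 'l::complex_hilbert) \<Rightarrow> 'l set \<Rightarrow> bool"
  where "is_L2_completion M \<phi> \<iota> L \<longleftrightarrow>
    (\<forall>a\<in>M. \<forall>b\<in>M. \<iota> (a + b) = \<iota> a + \<iota> b) \<and>
    (\<forall>c. \<forall>a\<in>M. \<iota> (cscale c a) = c *\<^sub>C \<iota> a) \<and>
    (\<forall>a\<in>M. norm (\<iota> a) = norm2 \<phi> a) \<and>
    L = closure (\<iota> ` M)"


section \<open>Free cumulants and free independence\<close>

definition oper_prod :: "'h::complex_hilbert oper list \<Rightarrow> 'h oper"
  where "oper_prod as = foldr (o\<^sub>L) as id_blinfun"

definition noncrossing_partitions :: "nat \<Rightarrow> nat set set set"
  where "noncrossing_partitions n =
    {P. partition_on {..<n} P \<and>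
      (\<forall>V\<in>P. \<forall>W\<in>P. \<forall>a\<in>V. \<forall>b\<in>W. \<forall>c\<in>V. \<forall>d\<in>W. a < b \<and> b < c \<and> c < d \<longrightarrow> V = W)}"

text \<open>
  The moment-cumulant formula: the moment of \<open>as\<close> is the sum over all noncrossing partitions
  of the products of the cumulants of the restrictions of \<open>as\<close> to the blocks. It is solved for
  the cumulant of \<open>as\<close> itself, which belongs to the partition with a single block.
\<close>

function free_cumulant ::
  "('h::complex_hilbert oper \<Rightarrow> complex) \<Rightarrow> 'h oper list \<Rightarrow> complex"
  where "free_cumulant \<phi> as = \<phi> (oper_prod as) -
    (\<Sum>P \<in> noncrossing_partitions (length as) - {{{..<length as}}}.
       \<Prod>V\<in>P. free_cumulant \<phi> (nths as V))"
  by pat_completeness auto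
termination
proof (relation "Wellfounded.measure (length \<circ> snd)", goal_cases)
  case (2 \<phi> as P V)
  let ?n = "length as"
  have part: "partition_on {..<?n} P" and ne: "P \<noteq> {{..<?n}}"
    using 2 by (auto simp: noncrossing_partitions_def)
  have sub: "V \<subseteq> {..<?n}"
    using partition_onD1[OF part] 2(2) by auto
  moreover have "V \<noteq> {..<?n}"
  proof
    assume V: "V = {..<?n}"
    have "W = V" if W: "W \<in> P" for W
    proof (rule ccontr)
      assume "W \<noteq> V"
      then have "W \<inter> V = {}"
        using disjointD[OF partition_onD2[OF part] W 2(2)] by simp
      moreover have "W \<subseteq> V"
        using partition_onD1[OF part] W V by blast
      ultimately show False
        using partition_onD3[OF part] W by (simp add: Int_absorb2)
    qed
    then have "P = {V}"
      using 2(2) by blast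
    then show False
      using ne V by simp
  qed
  ultimately have "card V < ?n"
    using psubset_card_mono[of "{..<?n}" V] by auto
  moreover have "{i. i < ?n \<and> i \<in> V} = V"
    using sub by auto
  ultimately show ?case
    by (simp add: length_nths)
qed simp

declare free_cumulant.simps [simp del]

inductive_set generated_algebra :: "'h::complex_hilbert oper set \<Rightarrow> 'h oper set"
  for S :: "'h::complex_hilbert oper set"
  where
    unit: "id_blinfun \<in> generated_algebra S"
  | base: "a \<in> S \<Longrightarrow> a \<in> generated_algebra S"
  | add: "a \<in> generated_algebra S \<Longrightarrow> b \<in> generated_algebra S \<Longrightarrow> a + b \<in> generated_algebra S"
  | scale: "a \<in> generated_algebra S \<Longrightarrow> cscale c a \<in> generated_algebra S"
  | mult: "a \<in> generated_algebra S \<Longrightarrow> b \<in> generated_algebra S \<Longrightarrow> a o\<^sub>L b \<in> generated_algebra S"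

text \<open>Alternating products of centered elements of the generated algebras are centered.\<close>

definition freely_independent ::
  "('h::complex_hilbert oper \<Rightarrow> complex) \<Rightarrow> 'i set \<Rightarrow> ('i \<Rightarrow> 'h oper) \<Rightarrow> bool"
  where "freely_independent \<phi> I x \<longleftrightarrow>
    (\<forall>as js. as \<noteq> [] \<longrightarrow> length js = length as \<longrightarrow> set js \<subseteq> I \<longrightarrow>
       (\<forall>j. Suc j < length js \<longrightarrow> js ! j \<noteq> js ! Suc j) \<longrightarrow>
       (\<forall>j < length as. as ! j \<in> generated_algebra {x (js ! j)} \<and> \<phi> (as ! j) = 0) \<longrightarrow>
       \<phi> (oper_prod as) = 0)"


section \<open>Free Poisson random measures and their integrals\<close>

definition finite_borel_sets :: "real set set"
  where "finite_borel_sets = {E \<in> sets borel. emeasure lborel E < \<infinity>}"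

definition free_poisson_random_measure ::
  "'h::complex_hilbert oper set \<Rightarrow> ('h oper \<Rightarrow> complex) \<Rightarrow> (real set \<Rightarrow> 'h oper) \<Rightarrow> bool"
  where "free_poisson_random_measure M \<phi> X \<longleftrightarrow>
    (\<forall>E\<in>finite_borel_sets. X E \<in> M \<and> self_adjoint (X E)) \<and>
    (\<forall>E\<in>finite_borel_sets. \<forall>n\<ge>1.
       free_cumulant \<phi> (replicate n (X E)) = complex_of_real (measure lborel E)) \<and>
    (\<forall>k\<ge>1. \<forall>E :: nat \<Rightarrow> real set.
       (\<forall>i<k. E i \<in> finite_borel_sets) \<longrightarrow> disjoint_family_on E {..<k} \<longrightarrow>
       freely_independent \<phi> {..<k} (\<lambda>i. X (E i))) \<and>
    (\<forall>k\<ge>1. \<forall>E :: nat \<Rightarrow> real set.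
       (\<forall>i<k. E i \<in> finite_borel_sets) \<longrightarrow> disjoint_family_on E {..<k} \<longrightarrow>
       X (\<Union>i<k. E i) = (\<Sum>i<k. X (E i)))"

text \<open>
  A simple function is given by a presentation, a list of pairs of a coefficient and a set.
  Limits of integrals of simple functions are below required for all choices of presentations.
\<close>

type_synonym simple_fun = "(real \<times> real set) list"

definition is_simple :: "simple_fun \<Rightarrow> bool"
  where "is_simple s \<longleftrightarrow>
    snd ` set s \<subseteq> finite_borel_sets \<and>
    (\<forall>i<length s. \<forall>j<length s. i \<noteq> j \<longrightarrow> snd (s ! i) \<inter> snd (s ! j) = {})"

definition simple_value :: "simple_fun \<Rightarrow> real \<Rightarrow> real"
  where "simple_value s x = (\<Sum>(c, E)\<leftarrow>s. c * indicator E x)"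

definition simple_integral ::
  "(real set \<Rightarrow> 'h::complex_hilbert oper) \<Rightarrow> simple_fun \<Rightarrow> 'h oper"
  where "simple_integral X s = (\<Sum>(c, E)\<leftarrow>s. c *\<^sub>R X E)"

definition square_integrable :: "(real \<Rightarrow> real) \<Rightarrow> bool"
  where "square_integrable f \<longleftrightarrow>
    f \<in> borel_measurable lebesgue \<and> integrable lebesgue (\<lambda>x. (f x)\<^sup>2)"

definition L2_dist :: "(real \<Rightarrow> real) \<Rightarrow> (real \<Rightarrow> real) \<Rightarrow> real"
  where "L2_dist f g = sqrt (integral\<^sup>L lebesgue (\<lambda>x. (f x - g x)\<^sup>2))"

text \<open>Meaningful for square integrable \<open>f\<close> vanishing outside a set of finite measure.\<close>

definition poisson_integral ::
  "('h::complex_hilbert oper \<Rightarrow> 'l::complex_hilbert) \<Rightarrow> (real set \<Rightarrow> 'h oper) \<Rightarrow>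
    (real \<Rightarrow> real) \<Rightarrow> 'l"
  where "poisson_integral \<iota> X f =
    (THE Y. \<forall>s :: nat \<Rightarrow> simple_fun.
       (\<forall>n. is_simple (s n) \<and> {x. simple_value (s n) x \<noteq> 0} \<subseteq> {x. f x \<noteq> 0}) \<longrightarrow>
       (\<lambda>n. L2_dist (simple_value (s n)) f) \<longlonglongrightarrow> 0 \<longrightarrow>
       (\<lambda>n. \<iota> (simple_integral X (s n))) \<longlonglongrightarrow> Y)"

definition truncated_poisson_integral ::
  "('h::complex_hilbert oper \<Rightarrow> 'l::complex_hilbert) \<Rightarrow> (real set \<Rightarrow> 'h oper) \<Rightarrow>
    (real \<Rightarrow> real) \<Rightarrow> real \<Rightarrow> 'l"
  where "truncated_poisson_integral \<iota> X f t =
    poisson_integral \<iota> X (\<lambda>x. f x * indicator {-t..t} x)"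

end

theory Submission
  imports Defs
begin

text \<open>
  The first two cumulants of \<open>X E\<close> give \<open>\<phi> (X E) = |E|\<close> and \<open>\<phi> ((X E)\<^sup>2) = |E| + |E|\<^sup>2\<close>, and freeness
  makes \<open>\<phi>\<close> multiplicative on \<open>X E\<close> and \<open>X F\<close> for disjoint \<open>E\<close> and \<open>F\<close>. Cutting two overlapping sets
  along their intersection turns this into \<open>\<phi> (X E X F) = |E \<inter> F| + |E| |F|\<close>
  (\<open>state_random_measure_mult\<close>), and bilinearity into the isometry
  \<open>\<parallel>X(s) - X(r)\<parallel>\<^sup>2 = \<integral>(s - r)\<^sup>2 + (\<integral>s - \<integral>r)\<^sup>2\<close>
  for simple functions (\<open>norm_simple_integral_diff\<close>). Hence \<open>X\<close> is continuous on simple functions for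
  the topology generated by the \<open>L\<^sup>2\<close> distance and the integral. This is where integrability of
  \<open>f\<close> enters: the means of the \<open>X E\<close> contribute the second term, which the \<open>L\<^sup>2\<close> distance does not
  control on a set of infinite measure.

  Every function in the intersection of \<open>L\<^sup>1\<close> and \<open>L\<^sup>2\<close> is a limit of simple functions in that topology
  (\<open>ex_simple_approximation\<close>), so it has an integral in \<open>L\<close>, and integrals of different functions
  satisfy an inequality of the same kind (\<open>norm_simple_integral_limit_diff_le\<close>). For a function that
  vanishes outside a bounded interval, \<open>L\<^sup>2\<close> convergence of simple functions on its support already
  implies convergence of the integrals, by the Cauchy-Schwarz inequality; therefore its integral is
  the one that defines \<open>X(f, t)\<close> (\<open>poisson_integral_eq_limit\<close>). Finally, by dominated convergence, the
  truncations of \<open>f\<close> to \<open>[-t, t]\<close> tend to \<open>f\<close> in the \<open>L\<^sup>2\<close> distance and in the integral, so \<open>X(f, t)\<close> tends to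
  the integral of \<open>f\<close>.
\<close>

section \<open>Bounded operators and von Neumann algebras\<close>

lemma scaleR_eq_cscale: "r *\<^sub>R T = cscale (complex_of_real r) T"
  by (rule blinfun_eqI) (simp add: cscale_apply scaleC_of_real scaleR_blinfun.rep_eq)

lemma bounded_operators_closed:
  "id_blinfun \<in> bounded_operators"
  "S \<in> bounded_operators \<Longrightarrow> T \<in> bounded_operators \<Longrightarrow> S + T \<in> bounded_operators"
  "T \<in> bounded_operators \<Longrightarrow> cscale c T \<in> bounded_operators"
  "S \<in> bounded_operators \<Longrightarrow> T \<in> bounded_operators \<Longrightarrow> S o\<^sub>L T \<in> bounded_operators"
  by (auto simp: bounded_operators_def plus_blinfun.rep_eq scaleC_add_right cscale_apply
      scaleC_scaleC mult.commute)

lemma compose_cscale_left: "cscale c S o\<^sub>L T = cscale c (S o\<^sub>L T)"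
  by (rule blinfun_eqI) (simp add: cscale_apply)

lemma compose_cscale_right:
  "S \<in> bounded_operators \<Longrightarrow> S o\<^sub>L cscale c T = cscale c (S o\<^sub>L T)"
  by (rule blinfun_eqI) (simp add: cscale_apply bounded_operators_def)

lemma compose_add_left: "(S + S') o\<^sub>L T = (S o\<^sub>L T) + (S' o\<^sub>L T)"
  by (rule blinfun_eqI) (simp add: plus_blinfun.rep_eq)

lemma compose_add_right: "T o\<^sub>L (S + S') = (T o\<^sub>L S) + (T o\<^sub>L S')"
  by (rule blinfun_eqI) (simp add: plus_blinfun.rep_eq blinfun.add_right)

lemma blinfun_compose_assoc: "(S o\<^sub>L T) o\<^sub>L U = S o\<^sub>L (T o\<^sub>L U)"
  by (rule blinfun_eqI) simp

lemma compose_id [simp]: "T o\<^sub>L id_blinfun = T" "id_blinfun o\<^sub>L T = T"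
  by (rule blinfun_eqI, simp)+

lemma commutant_closed:
  assumes "A \<subseteq> bounded_operators"
  shows "id_blinfun \<in> commutant A"
    and "S \<in> commutant A \<Longrightarrow> T \<in> commutant A \<Longrightarrow> S + T \<in> commutant A"
    and "T \<in> commutant A \<Longrightarrow> cscale c T \<in> commutant A"
    and "S \<in> commutant A \<Longrightarrow> T \<in> commutant A \<Longrightarrow> S o\<^sub>L T \<in> commutant A"
proof -
  show "id_blinfun \<in> commutant A"
    by (simp add: commutant_def bounded_operators_closed)
  show "S \<in> commutant A \<Longrightarrow> T \<in> commutant A \<Longrightarrow> S + T \<in> commutant A"
    by (simp add: commutant_def bounded_operators_closed compose_add_left compose_add_right)
  show "T \<in> commutant A \<Longrightarrow> cscale c T \<in> commutant A"
    using assms by (auto simp: commutant_def bounded_operators_closed compose_cscale_left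
        compose_cscale_right)
  show "S \<in> commutant A \<Longrightarrow> T \<in> commutant A \<Longrightarrow> S o\<^sub>L T \<in> commutant A"
    by (auto simp: commutant_def bounded_operators_closed blinfun_compose_assoc)
      (simp add: blinfun_compose_assoc[symmetric])
qed

text \<open>
  The adjoint is a definite description, and its uniqueness follows because an operator is determined
  by the inner products with its values.
\<close>

lemma adj_eq_self:
  assumes "self_adjoint (T :: 'h::complex_hilbert oper)"
  shows "adj T = T"
  unfolding adj_def
proof (rule the_equality)
  show "\<forall>x y. cinner (blinfun_apply T x) y = cinner x (blinfun_apply T y)"
    using assms by (simp add: self_adjoint_def)
next
  fix S :: "'h oper"
  assume S: "\<forall>x y. cinner (blinfun_apply T x) y = cinner x (blinfun_apply S y)"
  show "S = T"
  proof (rule blinfun_eqI)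
    fix y
    have "inner x (blinfun_apply S y) = inner x (blinfun_apply T y)" for x
      using S assms by (simp add: inner_eq_Re_cinner self_adjoint_def)
    then show "blinfun_apply S y = blinfun_apply T y"
      using vector_eq_ldot by blast
  qed
qed

lemma self_adjoint_add:
  "self_adjoint S \<Longrightarrow> self_adjoint T \<Longrightarrow> self_adjoint (S + T)"
proof -
  have "cinner z (x + y) = cinner z x + cinner z y" for x y z :: 'a
    by (metis cinner_add_left cinner_commute complex_cnj_add)
  then show "self_adjoint S \<Longrightarrow> self_adjoint T \<Longrightarrow> self_adjoint (S + T)"
    by (simp add: self_adjoint_def plus_blinfun.rep_eq cinner_add_left)
qed

lemma self_adjoint_scaleR: "self_adjoint T \<Longrightarrow> self_adjoint (r *\<^sub>R T)"
proof -
  have "cinner y (complex_of_real r *\<^sub>C x) = r * cinner y x" for x y :: 'a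
    by (metis cinner_scaleC_left cinner_commute complex_cnj_mult complex_cnj_complex_of_real)
  then show "self_adjoint T \<Longrightarrow> self_adjoint (r *\<^sub>R T)"
    by (simp add: self_adjoint_def scaleR_eq_cscale cscale_apply cinner_scaleC_left)
qed

section \<open>Cumulants of order one and two, and the trace\<close>

lemma free_cumulant_single: "free_cumulant \<phi> [a] = \<phi> a"
proof -
  have "P = {{..<1}}" if P: "partition_on {..<1::nat} P" for P
  proof -
    have one: "{..<1::nat} = {0}" by auto
    have "V = {0}" if "V \<in> P" for V
      using partition_onD1[OF P] partition_onD3[OF P] that one
      by (metis Union_upper subset_singletonD)
    moreover have "P \<noteq> {}"
      using partition_onD1[OF P] by auto
    ultimately show ?thesis by (auto simp: lessThan_Suc)
  qed
  then have partitions: "noncrossing_partitions 1 - {{{..<1}}} = {}"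
    by (auto simp: noncrossing_partitions_def)
  have length: "length [a] = 1"
    by simp
  show ?thesis
    using free_cumulant.simps[of \<phi> "[a]", unfolded length partitions]
    by (simp add: oper_prod_def)
qed

text \<open>
  The only noncrossing partition of two points besides the one-block partition is the one into
  singletons, so the second cumulant is the covariance.
\<close>

lemma free_cumulant_pair:
  "free_cumulant \<phi> [a, b] = \<phi> (a o\<^sub>L b) - \<phi> a * \<phi> b"
proof -
  have two: "{..<2} = {0, 1::nat}" by auto
  have "P = {{0}, {1}}" if P: "partition_on {..<2::nat} P" "P \<noteq> {{..<2}}" for P
  proof -
    have sub: "V \<subseteq> {0, 1}" "V \<noteq> {}" if "V \<in> P" for V
      using partition_onD1[OF P(1)] partition_onD3[OF P(1)] that two by auto
    have "{0, 1} \<notin> P"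
    proof
      assume V: "{0, 1} \<in> P"
      have "W = {0, 1}" if "W \<in> P" for W
        using disjointD[OF partition_onD2[OF P(1)] V that] sub[OF that] by blast
      then have "P = {{0, 1}}" using V by blast
      then show False using P(2) two by simp
    qed
    have cases: "V = {0} \<or> V = {1}" if V: "V \<in> P" for V
    proof -
      have "V \<in> Pow {0, 1}" "V \<noteq> {}" "V \<noteq> {0, 1}"
        using sub[OF V] V \<open>{0, 1} \<notin> P\<close> by auto
      then show ?thesis unfolding Pow_insert Pow_empty by blast
    qed
    have "0 \<in> \<Union>P" "1 \<in> \<Union>P"
      using partition_onD1[OF P(1)] two by auto
    then obtain V W where "V \<in> P" "0 \<in> V" "W \<in> P" "1 \<in> W"
      by blast
    then have "{0} \<in> P" "{1} \<in> P"
      using cases[of V] cases[of W] by auto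
    then show ?thesis using cases by blast
  qed
  then have "P = {{0}, {1}}" if "P \<in> noncrossing_partitions 2 - {{{..<2}}}" for P
    using that unfolding noncrossing_partitions_def by blast
  moreover have "{{0}, {1}} \<in> noncrossing_partitions 2"
    by (auto simp: noncrossing_partitions_def partition_on_def disjoint_def two)
  moreover have "{{0}, {1}} \<noteq> {{..<2::nat}}"
    using two by (auto simp: doubleton_eq_iff)
  ultimately have partitions: "noncrossing_partitions 2 - {{{..<2}}} = {{{0}, {1}}}"
    by blast
  have length: "length [a, b] = 2"
    by simp
  have "free_cumulant \<phi> [a, b] = \<phi> (oper_prod [a, b]) -
      (\<Sum>P\<in>{{{0}, {1}}}. \<Prod>V\<in>P. free_cumulant \<phi> (nths [a, b] V))"
    by (rule free_cumulant.simps[of \<phi> "[a, b]", unfolded length partitions])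
  also have "(\<Sum>P\<in>{{{0}, {1}}}. \<Prod>V\<in>P. free_cumulant \<phi> (nths [a, b] V)) = \<phi> a * \<phi> b"
    by (simp add: nths_Cons free_cumulant_single)
  finally show ?thesis
    by (simp add: oper_prod_def)
qed

context w_star_probability_space
begin

lemma algebra_in_bounded_operators: "M \<subseteq> bounded_operators"
  using finite_vna by (simp add: finite_von_neumann_algebra_def von_neumann_algebra_def)

text \<open>
  The algebra is a commutant, namely that of its own commutant.
\<close>

lemma algebra_closed:
  shows "id_blinfun \<in> M"
    and "a \<in> M \<Longrightarrow> b \<in> M \<Longrightarrow> a + b \<in> M"
    and "a \<in> M \<Longrightarrow> cscale c a \<in> M"
    and "a \<in> M \<Longrightarrow> b \<in> M \<Longrightarrow> a o\<^sub>L b \<in> M"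
proof -
  have M: "commutant (commutant M) = M"
    using finite_vna by (simp add: finite_von_neumann_algebra_def von_neumann_algebra_def)
  have "commutant M \<subseteq> bounded_operators"
    by (auto simp: commutant_def)
  note * = commutant_closed[OF this, unfolded M]
  show "id_blinfun \<in> M"
    and "a \<in> M \<Longrightarrow> b \<in> M \<Longrightarrow> a + b \<in> M"
    and "a \<in> M \<Longrightarrow> cscale c a \<in> M"
    and "a \<in> M \<Longrightarrow> b \<in> M \<Longrightarrow> a o\<^sub>L b \<in> M"
    by (rule *; assumption)+
qed

lemma zero_in_algebra: "0 \<in> M"
  using algebra_closed(3)[OF algebra_closed(1), of 0] scaleR_eq_cscale[of 0 id_blinfun]
  by (metis of_real_0 scaleR_zero_left)

lemma scaleR_in_algebra: "a \<in> M \<Longrightarrow> r *\<^sub>R a \<in> M"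
  by (simp add: scaleR_eq_cscale algebra_closed(3))

lemma state_scaleR: "a \<in> M \<Longrightarrow> \<phi> (r *\<^sub>R a) = r * \<phi> a"
  by (simp add: scaleR_eq_cscale state_cscale)

lemma state_zero: "\<phi> 0 = 0"
  using state_scaleR[OF zero_in_algebra, of 0] by simp

text \<open>
  Freeness of two elements says in particular that their centered versions \<open>y\<close> have a product of
  trace zero; expanding that product gives the claim.
\<close>

lemma state_mult_of_free:
  assumes free: "freely_independent \<phi> {..<2::nat} x" and x: "x 0 \<in> M" "x 1 \<in> M"
  shows "\<phi> (x 0 o\<^sub>L x 1) = \<phi> (x 0) * \<phi> (x 1)"
proof -
  define y where "y i = x i + cscale (- \<phi> (x i)) id_blinfun" for i
  have yM: "y 0 \<in> M" "y 1 \<in> M"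
    using x by (simp_all add: y_def algebra_closed)
  have y0: "\<phi> (y 0) = 0" "\<phi> (y 1) = 0"
    using x by (simp_all add: y_def state_add state_cscale state_unit algebra_closed)
  have gen: "y i \<in> generated_algebra {x i}" for i
    by (simp add: y_def generated_algebra.intros)
  have "\<phi> (oper_prod [y 0, y 1]) = 0"
    using free[unfolded freely_independent_def, rule_format, of "[y 0, y 1]" "[0, 1]"] y0 gen
    by (fastforce simp: less_Suc_eq)
  moreover have "\<phi> (oper_prod [y 0, y 1]) = \<phi> (y 0 o\<^sub>L y 1)"
    by (simp add: oper_prod_def)
  moreover have "\<phi> (y 0 o\<^sub>L y 1) = \<phi> (y 0 o\<^sub>L x 1)"
    using yM x y0 algebra_in_bounded_operators
    by (simp add: y_def[of "Suc 0"] compose_add_right compose_cscale_right subsetD state_add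
        algebra_closed state_cscale)
  moreover have "\<phi> (y 0 o\<^sub>L x 1) = \<phi> (x 0 o\<^sub>L x 1) - \<phi> (x 0) * \<phi> (x 1)"
    using x by (simp add: y_def compose_add_left compose_cscale_left state_add
        algebra_closed state_cscale)
  ultimately show ?thesis by simp
qed

end

section \<open>Simple functions\<close>

lemma simple_value_simps [simp]:
  "simple_value [] = (\<lambda>x. 0)"
  "simple_value ((c, E) # s) = (\<lambda>x. c * indicator E x + simple_value s x)"
  by (auto simp: simple_value_def)

lemma simple_integral_simps [simp]:
  "simple_integral X [] = 0"
  "simple_integral X ((c, E) # s) = c *\<^sub>R X E + simple_integral X s"
  by (auto simp: simple_integral_def)

lemma finite_borel_sets_lebesgue:
  assumes "E \<in> finite_borel_sets"
  shows "E \<in> sets lebesgue" "emeasure lebesgue E < \<infinity>" "E \<in> sets borel"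
    "measure lebesgue E = measure lborel E"
  using assms by (auto simp: finite_borel_sets_def)

lemma finite_borel_sets_closed:
  assumes "E \<in> finite_borel_sets" "F \<in> sets borel"
  shows "E \<inter> F \<in> finite_borel_sets" "E - F \<in> finite_borel_sets"
proof -
  have "emeasure lborel (E \<inter> F) \<le> emeasure lborel E" "emeasure lborel (E - F) \<le> emeasure lborel E"
    using assms by (auto intro!: emeasure_mono simp: finite_borel_sets_def)
  then show "E \<inter> F \<in> finite_borel_sets" "E - F \<in> finite_borel_sets"
    using assms by (auto simp: finite_borel_sets_def)
qed

lemma simple_value_integrable:
  assumes "snd ` set s \<subseteq> finite_borel_sets"
  shows "integrable lebesgue (simple_value s)"
  using assms
proof (induction s)
  case (Cons p s)
  then show ?case
    by (cases p) (auto intro!: Bochner_Integration.integrable_add integrable_mult_right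
        integrable_real_indicator dest: finite_borel_sets_lebesgue)
qed simp

lemma simple_value_product_integrable:
  assumes "snd ` set s \<subseteq> finite_borel_sets" "integrable lebesgue g"
  shows "integrable lebesgue (\<lambda>x. simple_value s x * g x)"
  using assms
proof (induction s)
  case (Cons p s)
  obtain c E where p: "p = (c, E)" by force
  have "integrable lebesgue (\<lambda>x. c * (g x * indicator E x))"
    using Cons.prems p by (intro integrable_mult_right integrable_real_mult_indicator)
      (auto dest: finite_borel_sets_lebesgue)
  moreover have "integrable lebesgue (\<lambda>x. simple_value s x * g x)"
    using Cons by simp
  ultimately show ?case
    by (simp add: p algebra_simps)
qed simp

text \<open>
  Concatenating presentations adds both values and integrals. The resulting sets may overlap, so the
  list need not present a simple function in the sense of \<open>is_simple\<close>; this is why the trace formulas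
  below are stated for all lists of sets of finite measure. Common refinements are thereby avoided.
\<close>

lemma simple_difference:
  defines "neg \<equiv> map (\<lambda>(c, E). (- c, E))"
  shows "simple_value (s @ neg r) = (\<lambda>x. simple_value s x - simple_value r x)"
    and "simple_integral X (s @ neg r) = simple_integral X s - simple_integral X r"
    and "snd ` set (s @ neg r) = snd ` set s \<union> snd ` set r"
proof -
  have 1: "simple_value (neg r) x = - simple_value r x" for x
    unfolding neg_def by (induction r) auto
  have 2: "simple_integral X (neg r) = - simple_integral X r"
    unfolding neg_def by (induction r) auto
  show "simple_value (s @ neg r) = (\<lambda>x. simple_value s x - simple_value r x)"
    using 1 by (auto simp: simple_value_def)
  show "simple_integral X (s @ neg r) = simple_integral X s - simple_integral X r"
    using 2 by (simp add: simple_integral_def)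
  show "snd ` set (s @ neg r) = snd ` set s \<union> snd ` set r"
    by (force simp: neg_def image_Un image_image split_beta)
qed

section \<open>The trace of products of simple integrals\<close>

locale free_poisson_space = w_star_probability_space M \<phi>
  for M :: "'h::complex_hilbert oper set" and \<phi> +
  fixes X :: "real set \<Rightarrow> 'h oper"
  assumes random_measure: "free_poisson_random_measure M \<phi> X"
begin

lemma random_measure_in_algebra: "E \<in> finite_borel_sets \<Longrightarrow> X E \<in> M"
  and random_measure_self_adjoint: "E \<in> finite_borel_sets \<Longrightarrow> self_adjoint (X E)"
  using random_measure by (auto simp: free_poisson_random_measure_def)

lemma state_random_measure:
  assumes "E \<in> finite_borel_sets"
  shows "\<phi> (X E) = complex_of_real (measure lborel E)"
proof -
  have "free_cumulant \<phi> (replicate 1 (X E)) = complex_of_real (measure lborel E)"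
    using random_measure assms unfolding free_poisson_random_measure_def by blast
  then show ?thesis by (simp add: free_cumulant_single)
qed

text \<open>
  The second cumulant is the variance, which therefore equals \<open>|E|\<close>.
\<close>

lemma state_random_measure_square:
  assumes "E \<in> finite_borel_sets"
  shows "\<phi> (X E o\<^sub>L X E) = complex_of_real (measure lborel E + (measure lborel E)\<^sup>2)"
proof -
  have "free_cumulant \<phi> (replicate 2 (X E)) = complex_of_real (measure lborel E)"
    using random_measure assms unfolding free_poisson_random_measure_def by (meson one_le_numeral)
  then show ?thesis
    by (simp add: numeral_2_eq_2 free_cumulant_pair state_random_measure[OF assms]
        diff_eq_eq power2_eq_square)
qed

lemma
  assumes "E \<in> finite_borel_sets" "F \<in> finite_borel_sets" "E \<inter> F = {}"
  shows random_measure_disjoint_Un: "X (E \<union> F) = X E + X F"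
    and state_random_measure_disjoint:
      "\<phi> (X E o\<^sub>L X F) = complex_of_real (measure lborel E * measure lborel F)"
proof -
  define G where "G i = (if i = 0 then E else F)" for i :: nat
  have G: "\<forall>i<2. G i \<in> finite_borel_sets" "disjoint_family_on G {..<2}"
    using assms by (auto simp: G_def disjoint_family_on_def less_2_cases_iff)
  have two: "{..<2} = {0, 1::nat}" by auto
  have "X (\<Union>i<2. G i) = (\<Sum>i<2. X (G i))"
    using random_measure G unfolding free_poisson_random_measure_def by (meson one_le_numeral)
  then show "X (E \<union> F) = X E + X F"
    by (simp add: two G_def Un_commute)
  have "freely_independent \<phi> {..<2} (\<lambda>i. X (G i))"
    using random_measure G unfolding free_poisson_random_measure_def by (meson one_le_numeral)
  from state_mult_of_free[OF this]
  show "\<phi> (X E o\<^sub>L X F) = complex_of_real (measure lborel E * measure lborel F)"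
    using assms by (simp add: G_def random_measure_in_algebra state_random_measure)
qed

text \<open>
  With \<open>E\<close> and \<open>F\<close> cut into \<open>E \<inter> F\<close>, \<open>E - F\<close> and \<open>F - E\<close>, only the square of \<open>X (E \<inter> F)\<close> contributes
  more than the product of the means.
\<close>

lemma state_random_measure_mult:
  assumes E: "E \<in> finite_borel_sets" and F: "F \<in> finite_borel_sets"
  shows "\<phi> (X E o\<^sub>L X F) =
    complex_of_real (measure lborel (E \<inter> F) + measure lborel E * measure lborel F)"
proof -
  define A B C where "A = E \<inter> F" and "B = E - F" and "C = F - E"
  have mem: "A \<in> finite_borel_sets" "B \<in> finite_borel_sets" "C \<in> finite_borel_sets"
    using E F by (auto simp: A_def B_def C_def finite_borel_sets_closed finite_borel_sets_lebesgue)
  have disj: "A \<inter> B = {}" "A \<inter> C = {}" "B \<inter> C = {}" "B \<inter> A = {}"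
    and EF: "E = A \<union> B" "F = A \<union> C"
    by (auto simp: A_def B_def C_def)
  have X_EF: "X E = X A + X B" "X F = X A + X C"
    using mem disj by (simp_all add: EF random_measure_disjoint_Un)
  have m: "measure lborel (S \<union> T) = measure lborel S + measure lborel T"
    if "S \<in> finite_borel_sets" "T \<in> finite_borel_sets" "S \<inter> T = {}" for S T
    using that by (intro measure_Un2[THEN trans]) 
      (auto simp: finite_borel_sets_def fmeasurable_def Diff_triv Int_commute)
  have mEF: "measure lborel E = measure lborel A + measure lborel B"
    "measure lborel F = measure lborel A + measure lborel C"
    using mem disj by (simp_all add: EF m)
  have "\<phi> (X E o\<^sub>L X F) =
      \<phi> (X A o\<^sub>L X A) + \<phi> (X A o\<^sub>L X C) + (\<phi> (X B o\<^sub>L X A) + \<phi> (X B o\<^sub>L X C))"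
    using mem by (simp add: X_EF compose_add_left compose_add_right state_add algebra_closed
        random_measure_in_algebra)
  then show ?thesis
    using mem disj
    by (simp add: mEF A_def[symmetric] state_random_measure_square state_random_measure_disjoint
        algebra_simps power2_eq_square)
qed

lemma simple_integral_in_algebra:
  assumes "snd ` set s \<subseteq> finite_borel_sets"
  shows "simple_integral X s \<in> M"
  using assms
proof (induction s)
  case (Cons p s)
  then show ?case
    by (cases p) (auto simp: algebra_closed scaleR_in_algebra random_measure_in_algebra)
qed (simp add: zero_in_algebra)

lemma simple_integral_self_adjoint:
  assumes "snd ` set s \<subseteq> finite_borel_sets"
  shows "self_adjoint (simple_integral X s)"
  using assms
proof (induction s)
  case Nil
  have "cinner 0 y = cinner x 0" for x y :: 'h
    by (metis add_cancel_right_right cinner_add_left cinner_commute complex_cnj_zero)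
  then show ?case by (simp add: self_adjoint_def)
next
  case (Cons p s)
  then show ?case
    by (cases p) (auto simp: self_adjoint_add self_adjoint_scaleR random_measure_self_adjoint)
qed

text \<open>
  Both sides are bilinear in the simple functions and agree on indicator functions by
  \<open>state_random_measure_mult\<close>.
\<close>

lemma state_simple_integral_mult:
  assumes s: "snd ` set s \<subseteq> finite_borel_sets" and r: "snd ` set r \<subseteq> finite_borel_sets"
  shows "\<phi> (simple_integral X s o\<^sub>L simple_integral X r) = complex_of_real
    ((LINT x|lebesgue. simple_value s x * simple_value r x) +
     (LINT x|lebesgue. simple_value s x) * (LINT x|lebesgue. simple_value r x))"
proof -
  have one: "\<phi> (X E o\<^sub>L simple_integral X r) = complex_of_real
    ((LINT x|lebesgue. indicator E x * simple_value r x) +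
     measure lborel E * (LINT x|lebesgue. simple_value r x))"
    if E: "E \<in> finite_borel_sets" for E
    using r
  proof (induction r)
    case Nil
    then show ?case by (simp add: state_zero)
  next
    case (Cons p r)
    obtain d F where p: "p = (d, F)" by force
    have F: "F \<in> finite_borel_sets" and r: "snd ` set r \<subseteq> finite_borel_sets"
      using Cons.prems p by auto
    have EF: "E \<inter> F \<in> finite_borel_sets"
      using E F by (simp add: finite_borel_sets_closed finite_borel_sets_lebesgue)
    note leb = finite_borel_sets_lebesgue[OF E] finite_borel_sets_lebesgue[OF F]
      finite_borel_sets_lebesgue[OF EF]
    have "\<phi> (X E o\<^sub>L simple_integral X (p # r)) =
        d * \<phi> (X E o\<^sub>L X F) + \<phi> (X E o\<^sub>L simple_integral X r)"
      using E F r algebra_in_bounded_operators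
      by (simp add: p compose_add_right scaleR_eq_cscale compose_cscale_right subsetD state_add
          state_cscale algebra_closed random_measure_in_algebra simple_integral_in_algebra)
    moreover have "(LINT x|lebesgue. indicator E x * simple_value (p # r) x) =
        d * measure lborel (E \<inter> F) + (LINT x|lebesgue. indicator E x * simple_value r x)"
    proof -
      have "integrable lebesgue (\<lambda>x. simple_value [(1, E)] x * simple_value r x)"
        using E simple_value_integrable[OF r] by (intro simple_value_product_integrable) auto
      then have "integrable lebesgue (\<lambda>x. indicator E x * simple_value r x)"
        by simp
      moreover have "(\<lambda>x. indicator E x * simple_value (p # r) x) =
          (\<lambda>x. d * indicator (E \<inter> F) x + indicator E x * simple_value r x)"
        by (auto simp: p indicator_def)
      ultimately show ?thesis
        using leb by simp
    qed
    moreover have "(LINT x|lebesgue. simple_value (p # r) x) =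
        d * measure lborel F + (LINT x|lebesgue. simple_value r x)"
      using leb simple_value_integrable[OF r] by (simp add: p)
    ultimately show ?case
      using Cons.IH[OF r] state_random_measure_mult[OF E F] by (simp add: algebra_simps)
  qed
  show ?thesis
    using s
  proof (induction s)
    case Nil
    then show ?case by (simp add: state_zero)
  next
    case (Cons p s)
    obtain c E where p: "p = (c, E)" by force
    have E: "E \<in> finite_borel_sets" and s: "snd ` set s \<subseteq> finite_borel_sets"
      using Cons.prems p by auto
    note leb = finite_borel_sets_lebesgue[OF E]
    have "\<phi> (simple_integral X (p # s) o\<^sub>L simple_integral X r) =
        c * \<phi> (X E o\<^sub>L simple_integral X r) + \<phi> (simple_integral X s o\<^sub>L simple_integral X r)"
      using E s r
      by (simp add: p compose_add_left scaleR_eq_cscale compose_cscale_left state_add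
          state_cscale algebra_closed random_measure_in_algebra simple_integral_in_algebra)
    moreover have "(LINT x|lebesgue. simple_value (p # s) x * simple_value r x) =
        c * (LINT x|lebesgue. indicator E x * simple_value r x) +
        (LINT x|lebesgue. simple_value s x * simple_value r x)"
    proof -
      have "integrable lebesgue (\<lambda>x. simple_value [(1, E)] x * simple_value r x)"
        using E simple_value_integrable[OF r] by (intro simple_value_product_integrable) auto
      then have "integrable lebesgue (\<lambda>x. indicator E x * simple_value r x)"
        by simp
      moreover have "(\<lambda>x. simple_value (p # s) x * simple_value r x) =
          (\<lambda>x. c * (indicator E x * simple_value r x) + simple_value s x * simple_value r x)"
        by (auto simp: p algebra_simps)
      ultimately show ?thesis
        using simple_value_product_integrable[OF s simple_value_integrable[OF r]] by simp
    qed
    moreover have "(LINT x|lebesgue. simple_value (p # s) x) =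
        c * measure lborel E + (LINT x|lebesgue. simple_value s x)"
      using leb simple_value_integrable[OF s] by (simp add: p)
    ultimately show ?case
      using Cons.IH[OF s] one[OF E] by (simp add: algebra_simps)
  qed
qed

lemma norm2_simple_integral:
  assumes s: "snd ` set s \<subseteq> finite_borel_sets"
  shows "(norm2 \<phi> (simple_integral X s))\<^sup>2 =
    (LINT x|lebesgue. (simple_value s x)\<^sup>2) + (LINT x|lebesgue. simple_value s x)\<^sup>2"
proof -
  have "0 \<le> (LINT x|lebesgue. (simple_value s x)\<^sup>2)"
    by simp
  then show ?thesis
    by (simp add: norm2_def adj_eq_self simple_integral_self_adjoint s
        state_simple_integral_mult power2_eq_square[symmetric])
qed

end


section \<open>Estimates in L2\<close>

lemma L2_dist_square: "(L2_dist f g)\<^sup>2 = (LINT x|lebesgue. (f x - g x)\<^sup>2)"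
  by (simp add: L2_dist_def)

lemma L2_dist_nonneg: "0 \<le> L2_dist f g"
  by (simp add: L2_dist_def)

lemma square_integrable_diff:
  assumes "square_integrable f" "square_integrable g"
  shows "integrable lebesgue (\<lambda>x. (f x - g x)\<^sup>2)"
proof (rule Bochner_Integration.integrable_bound)
  show "integrable lebesgue (\<lambda>x. 2 * (f x)\<^sup>2 + 2 * (g x)\<^sup>2)"
    using assms by (simp add: square_integrable_def)
  show "(\<lambda>x. (f x - g x)\<^sup>2) \<in> borel_measurable lebesgue"
    using assms unfolding square_integrable_def
    by (intro borel_measurable_power borel_measurable_diff) auto
  have "(f x - g x)\<^sup>2 \<le> 2 * (f x)\<^sup>2 + 2 * (g x)\<^sup>2" for x
    using zero_le_power2[of "f x + g x"] by (simp add: power2_eq_square algebra_simps)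
  then show "AE x in lebesgue. norm ((f x - g x)\<^sup>2) \<le> norm (2 * (f x)\<^sup>2 + 2 * (g x)\<^sup>2)"
    by simp
qed

text \<open>
  A squared triangle inequality along the path \<open>a\<close>, \<open>b\<close>, \<open>c\<close>, \<open>d\<close>. Allowing the factor 3 makes it an
  integrated pointwise inequality, which is enough for convergence arguments.
\<close>

lemma L2_dist_quadrilateral:
  assumes "square_integrable a" "square_integrable b" "square_integrable c" "square_integrable d"
  shows "(L2_dist a d)\<^sup>2 \<le> 3 * (L2_dist a b)\<^sup>2 + 3 * (L2_dist b c)\<^sup>2 + 3 * (L2_dist d c)\<^sup>2"
proof -
  note int = square_integrable_diff[OF assms(1,4)] square_integrable_diff[OF assms(1,2)]
    square_integrable_diff[OF assms(2,3)] square_integrable_diff[OF assms(4,3)]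
  have "(a x - d x)\<^sup>2 \<le> 3 * (a x - b x)\<^sup>2 + 3 * (b x - c x)\<^sup>2 + 3 * (d x - c x)\<^sup>2" for x
  proof -
    have "(p + q - r)\<^sup>2 \<le> 3 * p\<^sup>2 + 3 * q\<^sup>2 + 3 * r\<^sup>2" for p q r :: real
      using zero_le_power2[of "p - q"] zero_le_power2[of "p + r"] zero_le_power2[of "q + r"]
      by (simp add: power2_eq_square algebra_simps)
    from this[of "a x - b x" "b x - c x" "d x - c x"] show ?thesis by simp
  qed
  then have "(LINT x|lebesgue. (a x - d x)\<^sup>2) \<le>
      (LINT x|lebesgue. 3 * (a x - b x)\<^sup>2 + 3 * (b x - c x)\<^sup>2 + 3 * (d x - c x)\<^sup>2)"
    using int by (intro integral_mono) auto
  then show ?thesis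
    using int by (simp add: L2_dist_square)
qed

text \<open>
  The Cauchy-Schwarz inequality against the indicator function of the interval, proved by integrating
  the square of the deviation of \<open>u\<close> from its mean \<open>m\<close> over the interval.
\<close>

lemma abs_integral_le_L2:
  assumes u: "integrable lebesgue u" "integrable lebesgue (\<lambda>x. (u x)\<^sup>2)"
    and supp: "\<And>x. x \<notin> {a..b} \<Longrightarrow> u x = 0" and "a < b"
  shows "\<bar>LINT x|lebesgue. u x\<bar> \<le> sqrt (b - a) * sqrt (LINT x|lebesgue. (u x)\<^sup>2)"
proof -
  define m where "m = (LINT x|lebesgue. u x) / (b - a)"
  have "(u x - m * indicator {a..b} x)\<^sup>2 =
      (u x)\<^sup>2 - 2 * m * u x + m\<^sup>2 * indicator {a..b} x" for x
    using supp[of x] by (cases "x \<in> {a..b}") (auto simp: power2_eq_square algebra_simps)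
  moreover have "0 \<le> (LINT x|lebesgue. (u x - m * indicator {a..b} x)\<^sup>2)"
    by simp
  ultimately have "0 \<le> (LINT x|lebesgue. (u x)\<^sup>2 - 2 * m * u x + m\<^sup>2 * indicator {a..b} x)"
    by simp
  also have "\<dots> = (LINT x|lebesgue. (u x)\<^sup>2) - 2 * m * (LINT x|lebesgue. u x) + m\<^sup>2 * (b - a)"
    using u \<open>a < b\<close> by (simp add: )
  also have "\<dots> = (LINT x|lebesgue. (u x)\<^sup>2) - (LINT x|lebesgue. u x)\<^sup>2 / (b - a)"
  proof -
    have "m * (b - a) = (LINT x|lebesgue. u x)"
      using \<open>a < b\<close> by (simp add: m_def)
    then have "m\<^sup>2 * (b - a) = m * (LINT x|lebesgue. u x)"
      by (simp add: power2_eq_square)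
    then show ?thesis
      by (simp add: m_def power2_eq_square)
  qed
  finally have "(LINT x|lebesgue. u x)\<^sup>2 \<le> (b - a) * (LINT x|lebesgue. (u x)\<^sup>2)"
    using \<open>a < b\<close> by (simp add: field_simps)
  then show ?thesis
    using real_sqrt_le_mono by (fastforce simp: real_sqrt_mult[symmetric])
qed

lemma simple_value_square_integrable:
  assumes "snd ` set s \<subseteq> finite_borel_sets"
  shows "square_integrable (simple_value s)"
  using simple_value_product_integrable[OF assms simple_value_integrable[OF assms]]
    simple_value_integrable[OF assms]
  by (simp add: square_integrable_def power2_eq_square borel_measurable_integrable)

section \<open>Approximation by simple functions\<close>

text \<open>
  The sets of the presentation are the level sets of the nonzero values; they have finite measure since
  they lie in a bounded interval.
\<close>

lemma ex_simple_presentation: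
  assumes v: "simple_function lborel v" and supp: "{x. v x \<noteq> 0} \<subseteq> {a..b::real}"
  obtains s where "is_simple s" "simple_value s = v"
proof -
  have fin: "finite (range v - {0})"
    using simple_functionD(1)[OF v] by simp
  obtain cs where cs: "set cs = range v - {0}" "distinct cs"
    using finite_distinct_list[OF fin] by auto
  define s where "s = map (\<lambda>c. (c, v -` {c})) cs"
  have "v -` {c} \<in> finite_borel_sets" if "c \<noteq> 0" for c
  proof -
    have "v -` {c} \<in> sets lborel"
      using simple_functionD(2)[OF v, of "{c}"] by simp
    moreover have "emeasure lborel (v -` {c}) \<le> emeasure lborel {a..b}"
      using supp that by (intro emeasure_mono) auto
    then have "emeasure lborel (v -` {c}) < \<infinity>"
      by (rule le_less_trans) (simp add: emeasure_lborel_Icc_eq)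
    ultimately show ?thesis by (simp add: finite_borel_sets_def)
  qed
  then have "snd ` set s \<subseteq> finite_borel_sets"
    using cs by (auto simp: s_def)
  moreover have "snd (s ! i) \<inter> snd (s ! j) = {}" if "i < length s" "j < length s" "i \<noteq> j" for i j
    using that cs(2) by (auto simp: s_def nth_eq_iff_index_eq)
  ultimately have "is_simple s"
    by (simp add: is_simple_def)
  moreover have "simple_value s x = v x" for x
  proof -
    have "simple_value s x = (\<Sum>c\<in>range v - {0}. c * indicator (v -` {c}) x)"
      using cs by (simp add: simple_value_def s_def o_def sum_list_distinct_conv_sum_set)
    also have "\<dots> = (\<Sum>c\<in>range v - {0}. if v x = c then c else 0)"
      by (intro sum.cong) (auto simp: indicator_def)
    also have "\<dots> = v x"
      using fin by (simp add: sum.delta)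
    finally show ?thesis .
  qed
  ultimately show thesis
    using that by blast
qed

text \<open>
  Convergence of the integrals is part of the notion because the trace norm of a simple integral sees
  the \<open>L\<^sup>2\<close> distance and the integral, and nothing else.
\<close>

definition simple_approximation :: "(nat \<Rightarrow> simple_fun) \<Rightarrow> (real \<Rightarrow> real) \<Rightarrow> bool"
  where "simple_approximation s f \<longleftrightarrow>
    (\<forall>n. is_simple (s n)) \<and>
    (\<lambda>n. L2_dist (simple_value (s n)) f) \<longlonglongrightarrow> 0 \<and>
    (\<lambda>n. LINT x|lebesgue. simple_value (s n) x) \<longlonglongrightarrow> (LINT x|lebesgue. f x)"

text \<open>
  The sets in a presentation are Borel, whereas \<open>f\<close> is only Lebesgue measurable. Therefore the simple
  functions approximate a Borel function \<open>h\<close> equal to \<open>f\<close> almost everywhere. Since every value of \<open>h\<close> is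
  0 or the value of \<open>f\<close>, and the approximation is dominated by \<open>2 |h|\<close>, supports stay inside that of
  \<open>f\<close> exactly, and not only up to a null set. Dominated convergence does the rest.
\<close>

lemma ex_simple_approximation:
  assumes f: "integrable lebesgue f" "square_integrable f"
  obtains s where "simple_approximation s f"
    and "\<And>n. {x. simple_value (s n) x \<noteq> 0} \<subseteq> {x. f x \<noteq> 0}"
proof -
  have fm: "f \<in> borel_measurable lebesgue"
    using f by (simp add: borel_measurable_integrable)
  obtain g where g: "g \<in> borel_measurable lborel" "AE x in lborel. f x = g x"
    using completion_ex_borel_measurable_real[OF fm] by blast
  obtain N where N: "{x. f x \<noteq> g x} \<subseteq> N" "emeasure lborel N = 0" "N \<in> sets lborel"
    using AE_E[OF g(2)] by auto
  define h where "h x = g x * indicator (- N) x" for x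
  have "h \<in> borel_measurable lborel"
    unfolding h_def using g(1) N(3) by (intro borel_measurable_times borel_measurable_indicator) auto
  then obtain u where u: "\<And>i. simple_function lborel (u i)" "\<And>x. (\<lambda>i. u i x) \<longlonglongrightarrow> h x"
      "\<And>i x. dist (u i x) 0 \<le> 2 * dist (h x) 0"
    using borel_measurable_implies_sequence_metric[of h lborel 0] by auto
  \<comment> \<open>Cutting off at \<open>n\<close> makes the level sets bounded, hence of finite measure.\<close>
  define v where "v n x = u n x * indicator {- real n..real n} x" for n x
  have v: "simple_function lborel (v n)" for n
    unfolding v_def using u(1) by (intro simple_function_mult simple_function_indicator) auto
  have supp: "{x. v n x \<noteq> 0} \<subseteq> {- real n..real n}" for n
    by (auto simp: v_def indicator_def)
  have "\<exists>s. is_simple s \<and> simple_value s = v n" for n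
    using ex_simple_presentation[OF v supp] by metis
  then obtain s where s: "\<And>n. is_simple (s n)" "\<And>n. simple_value (s n) = v n"
    by metis
  have hf: "\<bar>h x\<bar> \<le> \<bar>f x\<bar>" for x
    proof (cases "x \<in> N")
    case False
    then have "f x = g x" using N(1) by blast
    then show ?thesis by (simp add: h_def indicator_def)
  qed (simp add: h_def)
  have v_le: "\<bar>v n x\<bar> \<le> 2 * \<bar>f x\<bar>" for n x
  proof -
    have "\<bar>v n x\<bar> \<le> \<bar>u n x\<bar>"
      by (auto simp: v_def indicator_def)
    then show ?thesis
      using u(3)[of n x] hf[of x] by simp
  qed
  have vm: "v n \<in> borel_measurable lebesgue" for n
    using borel_measurable_simple_function[OF v] measurable_completion by blast
  have "N \<in> null_sets lebesgue"
    using N by (intro null_sets_completionI) auto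
  then have lim: "AE x in lebesgue. (\<lambda>n. v n x) \<longlonglongrightarrow> f x"
  proof (rule AE_I', intro subsetI)
    fix x assume x: "x \<in> {x \<in> space lebesgue. \<not> (\<lambda>n. v n x) \<longlonglongrightarrow> f x}"
    show "x \<in> N"
    proof (rule ccontr)
      assume "x \<notin> N"
      then have "f x = g x" using N(1) by blast
      then have "h x = f x" using \<open>x \<notin> N\<close> by (simp add: h_def)
      moreover have "\<forall>\<^sub>F n in sequentially. u n x = v n x"
      proof -
        obtain k :: nat where "\<bar>x\<bar> \<le> real k"
          using real_arch_simple by blast
        then have "u n x = v n x" if "n \<ge> k" for n
          using that by (auto simp: v_def indicator_def)
        then show ?thesis
          by (rule eventually_sequentiallyI)
      qed
      ultimately have "(\<lambda>n. v n x) \<longlonglongrightarrow> f x"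
        using Lim_transform_eventually[OF u(2)[of x]] by simp
      then show False using x by simp
    qed
  qed
  have "(\<lambda>n. LINT x|lebesgue. v n x) \<longlonglongrightarrow> (LINT x|lebesgue. f x)"
    by (rule integral_dominated_convergence[where w = "\<lambda>x. 2 * \<bar>f x\<bar>"])
      (use f(1) fm vm lim v_le in auto)
  moreover have "(\<lambda>n. LINT x|lebesgue. (v n x - f x)\<^sup>2) \<longlonglongrightarrow> (LINT x::real|lebesgue. 0)"
  proof (rule integral_dominated_convergence[where w = "\<lambda>x. 9 * (f x)\<^sup>2"])
    show "(\<lambda>x. (v n x - f x)\<^sup>2) \<in> borel_measurable lebesgue" for n
      using vm fm by measurable
    show "integrable lebesgue (\<lambda>x. 9 * (f x)\<^sup>2)"
      using f(2) by (simp add: square_integrable_def)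
    show "AE x in lebesgue. (\<lambda>n. (v n x - f x)\<^sup>2) \<longlonglongrightarrow> 0"
      using lim by eventually_elim (auto intro!: tendsto_eq_intros)
    have "(v n x - f x)\<^sup>2 \<le> 9 * (f x)\<^sup>2" for n x
    proof -
      have "\<bar>v n x - f x\<bar> \<le> \<bar>3 * f x\<bar>"
        using v_le[of n x] by linarith
      then have "(v n x - f x)\<^sup>2 \<le> (3 * f x)\<^sup>2"
        by (simp only: abs_le_square_iff)
      then show ?thesis by (simp add: power_mult_distrib)
    qed
    then show "AE x in lebesgue. norm ((v n x - f x)\<^sup>2) \<le> 9 * (f x)\<^sup>2" for n
      by simp
  qed auto
  then have "(\<lambda>n. L2_dist (v n) f) \<longlonglongrightarrow> 0"
    unfolding L2_dist_def by (auto intro!: tendsto_eq_intros)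
  ultimately have "simple_approximation s f"
    using s by (simp add: simple_approximation_def)
  moreover have "{x. simple_value (s n) x \<noteq> 0} \<subseteq> {x. f x \<noteq> 0}" for n
  proof -
    have "v n x = 0" if "f x = 0" for x
      using v_le[of n x] that by simp
    then show ?thesis by (auto simp: s(2))
  qed
  ultimately show thesis
    using that by blast
qed

text \<open>
  On a bounded interval \<open>L\<^sup>2\<close> convergence implies \<open>L\<^sup>1\<close> convergence, so the definition of the Poisson
  integral, which asks for \<open>L\<^sup>2\<close> convergence only, yields approximations in the stronger sense.
\<close>

lemma simple_approximation_of_L2_limit:
  assumes f: "integrable lebesgue f" "square_integrable f"
    and supp: "\<And>x. x \<notin> {a..b} \<Longrightarrow> f x = 0" and "a < b"
    and s: "\<And>n. is_simple (s n)" "\<And>n. {x. simple_value (s n) x \<noteq> 0} \<subseteq> {x. f x \<noteq> 0}"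
    and lim: "(\<lambda>n. L2_dist (simple_value (s n)) f) \<longlonglongrightarrow> 0"
  shows "simple_approximation s f"
proof -
  have fin: "snd ` set (s n) \<subseteq> finite_borel_sets" for n
    using s(1) by (simp add: is_simple_def)
  have "\<bar>(LINT x|lebesgue. simple_value (s n) x) - (LINT x|lebesgue. f x)\<bar> \<le>
      sqrt (b - a) * L2_dist (simple_value (s n)) f" for n
  proof -
    have "\<bar>LINT x|lebesgue. simple_value (s n) x - f x\<bar> \<le>
        sqrt (b - a) * sqrt (LINT x|lebesgue. (simple_value (s n) x - f x)\<^sup>2)"
    proof (rule abs_integral_le_L2)
      show "simple_value (s n) x - f x = 0" if "x \<notin> {a..b}" for x
        using supp[OF that] s(2)[of n] by auto
    qed (use f simple_value_integrable[OF fin] simple_value_square_integrable[OF fin] \<open>a < b\<close>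
        in \<open>auto intro: square_integrable_diff\<close>)
    then show ?thesis
      using f simple_value_integrable[OF fin] by (simp add: L2_dist_def)
  qed
  then have "(\<lambda>n. (LINT x|lebesgue. simple_value (s n) x) - (LINT x|lebesgue. f x)) \<longlonglongrightarrow> 0"
    by (intro Lim_null_comparison[OF _ tendsto_mult_right_zero[OF lim, of "sqrt (b - a)"]]) auto
  then show ?thesis
    using s(1) lim by (simp add: simple_approximation_def LIM_zero_iff)
qed

section \<open>Integrals of functions in L1 and L2\<close>

locale free_poisson_integration = free_poisson_space M \<phi> X
  for M :: "'h::complex_hilbert oper set" and \<phi> and X +
  fixes \<iota> :: "'h oper \<Rightarrow> 'l::complex_hilbert"
    and L :: "'l set"
  assumes completion: "is_L2_completion M \<phi> \<iota> L"
begin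

lemma norm_simple_integral_diff:
  assumes s: "snd ` set s \<subseteq> finite_borel_sets" and r: "snd ` set r \<subseteq> finite_borel_sets"
  shows "(norm (\<iota> (simple_integral X s) - \<iota> (simple_integral X r)))\<^sup>2 =
    (LINT x|lebesgue. (simple_value s x - simple_value r x)\<^sup>2) +
    ((LINT x|lebesgue. simple_value s x) - (LINT x|lebesgue. simple_value r x))\<^sup>2"
proof -
  define u where "u = s @ map (\<lambda>(c, E). (- c, E)) r"
  have u: "snd ` set u \<subseteq> finite_borel_sets"
    using s r simple_difference(3)[of s r] by (simp add: u_def)
  have M: "simple_integral X u \<in> M" "simple_integral X r \<in> M"
    using simple_integral_in_algebra u r by auto
  have "\<iota> (simple_integral X u + simple_integral X r) =
      \<iota> (simple_integral X u) + \<iota> (simple_integral X r)"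
    using completion M unfolding is_L2_completion_def by blast
  then have "\<iota> (simple_integral X s) - \<iota> (simple_integral X r) = \<iota> (simple_integral X u)"
    by (simp add: u_def simple_difference)
  moreover have "norm (\<iota> (simple_integral X u)) = norm2 \<phi> (simple_integral X u)"
    using completion M unfolding is_L2_completion_def by blast
  ultimately show ?thesis
    using norm2_simple_integral[OF u] simple_value_integrable[OF s] simple_value_integrable[OF r]
    by (simp add: u_def simple_difference)
qed

text \<open>
  A linear form of the isometry in which the difference of the simple functions is routed through
  \<open>f\<close> and \<open>g\<close>. The case of equal \<open>f\<close> and \<open>g\<close> gives the Cauchy property of an approximation, the general case
  the continuity of the integral.
\<close>

lemma norm_simple_integral_diff_le:
  assumes s: "snd ` set s \<subseteq> finite_borel_sets" and r: "snd ` set r \<subseteq> finite_borel_sets"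
    and f: "square_integrable f" and g: "square_integrable g"
  shows "norm (\<iota> (simple_integral X s) - \<iota> (simple_integral X r)) \<le>
    2 * L2_dist (simple_value s) f + 2 * L2_dist f g + 2 * L2_dist (simple_value r) g +
    \<bar>(LINT x|lebesgue. simple_value s x) - (LINT x|lebesgue. simple_value r x)\<bar>"
proof -
  define p q w d where "p = L2_dist (simple_value s) f" and "q = L2_dist f g"
    and "w = L2_dist (simple_value r) g"
    and "d = \<bar>(LINT x|lebesgue. simple_value s x) - (LINT x|lebesgue. simple_value r x)\<bar>"
  have nn: "0 \<le> p" "0 \<le> q" "0 \<le> w" "0 \<le> d"
    by (simp_all add: p_def q_def w_def d_def L2_dist_nonneg)
  have "(norm (\<iota> (simple_integral X s) - \<iota> (simple_integral X r)))\<^sup>2 =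
      (L2_dist (simple_value s) (simple_value r))\<^sup>2 + d\<^sup>2"
    by (simp add: norm_simple_integral_diff[OF s r] L2_dist_square d_def)
  also have "\<dots> \<le> 3 * p\<^sup>2 + 3 * q\<^sup>2 + 3 * w\<^sup>2 + d\<^sup>2"
    using L2_dist_quadrilateral[OF simple_value_square_integrable[OF s] f g
        simple_value_square_integrable[OF r]] by (simp add: p_def q_def w_def)
  \<comment> \<open>The coefficient 2 suffices since 2 squared exceeds 3 and the mixed terms are nonnegative.\<close>
  also have "\<dots> \<le> (2 * p + 2 * q + 2 * w + d)\<^sup>2"
  proof -
    have "(2 * p + 2 * q + 2 * w + d)\<^sup>2 = 3 * p\<^sup>2 + 3 * q\<^sup>2 + 3 * w\<^sup>2 + d\<^sup>2 + (p\<^sup>2 + q\<^sup>2 + w\<^sup>2 +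
        8 * (p * q) + 8 * (p * w) + 8 * (q * w) + 4 * (p * d) + 4 * (q * d) + 4 * (w * d))"
      by (simp add: power2_eq_square algebra_simps)
    moreover have "0 \<le> p\<^sup>2 + q\<^sup>2 + w\<^sup>2 +
        8 * (p * q) + 8 * (p * w) + 8 * (q * w) + 4 * (p * d) + 4 * (q * d) + 4 * (w * d)"
      using nn by simp
    ultimately show ?thesis by linarith
  qed
  finally show ?thesis
    unfolding p_def[symmetric] q_def[symmetric] w_def[symmetric] d_def[symmetric]
    by (rule power2_le_imp_le) (use nn in simp)
qed

lemma simple_integral_limit_exists:
  assumes f: "square_integrable f" and s: "simple_approximation s f"
  obtains Y where "Y \<in> L" "(\<lambda>n. \<iota> (simple_integral X (s n))) \<longlonglongrightarrow> Y"
proof -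
  define c where "c n = 2 * L2_dist (simple_value (s n)) f +
    \<bar>(LINT x|lebesgue. simple_value (s n) x) - (LINT x|lebesgue. f x)\<bar>" for n
  have fin: "snd ` set (s n) \<subseteq> finite_borel_sets" for n
    using s by (simp add: simple_approximation_def is_simple_def)
  have "c \<longlonglongrightarrow> 0"
    using s unfolding c_def simple_approximation_def by (auto intro!: tendsto_eq_intros)
  have bound: "norm (\<iota> (simple_integral X (s m)) - \<iota> (simple_integral X (s n))) \<le> c m + c n" for m n
  proof -
    have "L2_dist f f = 0" by (simp add: L2_dist_def)
    then show ?thesis
      using norm_simple_integral_diff_le[OF fin[of m] fin[of n] f f] unfolding c_def by linarith
  qed
  have "Cauchy (\<lambda>n. \<iota> (simple_integral X (s n)))"
  proof (rule CauchyI)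
    fix e :: real assume "0 < e"
    then obtain k where k: "\<And>n. n \<ge> k \<Longrightarrow> c n < e / 2"
      using order_tendstoD(2)[OF \<open>c \<longlonglongrightarrow> 0\<close>, of "e / 2"]
      by (auto simp: eventually_sequentially)
    have "norm (\<iota> (simple_integral X (s m)) - \<iota> (simple_integral X (s n))) < e"
      if "m \<ge> k" "n \<ge> k" for m n
      using bound[of m n] k[OF that(1)] k[OF that(2)] by simp
    then show "\<exists>k. \<forall>m\<ge>k. \<forall>n\<ge>k.
        norm (\<iota> (simple_integral X (s m)) - \<iota> (simple_integral X (s n))) < e"
      by blast
  qed
  then obtain Y where Y: "(\<lambda>n. \<iota> (simple_integral X (s n))) \<longlonglongrightarrow> Y"
    using Cauchy_convergent_iff convergent_def by blast
  have "Y \<in> closure (\<iota> ` M)"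
    unfolding closure_sequential
    using Y simple_integral_in_algebra[OF fin]
    by (intro exI[of _ "\<lambda>n. \<iota> (simple_integral X (s n))"]) auto
  then show thesis
    using that Y completion by (simp add: is_L2_completion_def)
qed

text \<open>
  The limit of \<open>norm_simple_integral_diff_le\<close>. With \<open>f = g\<close> it shows that the limit does not depend on the
  approximation.
\<close>

lemma norm_simple_integral_limit_diff_le:
  assumes f: "square_integrable f" and g: "square_integrable g"
    and s: "simple_approximation s f" and r: "simple_approximation r g"
    and Y: "(\<lambda>n. \<iota> (simple_integral X (s n))) \<longlonglongrightarrow> Y"
    and Z: "(\<lambda>n. \<iota> (simple_integral X (r n))) \<longlonglongrightarrow> Z"
  shows "norm (Y - Z) \<le> 2 * L2_dist f g + \<bar>(LINT x|lebesgue. f x) - (LINT x|lebesgue. g x)\<bar>"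
proof (rule LIMSEQ_le)
  show "(\<lambda>n. norm (\<iota> (simple_integral X (s n)) - \<iota> (simple_integral X (r n)))) \<longlonglongrightarrow> norm (Y - Z)"
    using Y Z by (intro tendsto_intros)
  have "(\<lambda>n. 2 * L2_dist (simple_value (s n)) f + 2 * L2_dist f g +
      2 * L2_dist (simple_value (r n)) g +
      \<bar>(LINT x|lebesgue. simple_value (s n) x) - (LINT x|lebesgue. simple_value (r n) x)\<bar>)
    \<longlonglongrightarrow> 2 * 0 + 2 * L2_dist f g + 2 * 0 + \<bar>(LINT x|lebesgue. f x) - (LINT x|lebesgue. g x)\<bar>"
    using s r unfolding simple_approximation_def by (intro tendsto_intros) auto
  then show "(\<lambda>n. 2 * L2_dist (simple_value (s n)) f + 2 * L2_dist f g +
      2 * L2_dist (simple_value (r n)) g +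
      \<bar>(LINT x|lebesgue. simple_value (s n) x) - (LINT x|lebesgue. simple_value (r n) x)\<bar>)
    \<longlonglongrightarrow> 2 * L2_dist f g + \<bar>(LINT x|lebesgue. f x) - (LINT x|lebesgue. g x)\<bar>"
    by simp
  have fin: "snd ` set (s n) \<subseteq> finite_borel_sets" "snd ` set (r n) \<subseteq> finite_borel_sets" for n
    using s r by (simp_all add: simple_approximation_def is_simple_def)
  then show "\<exists>k. \<forall>n\<ge>k. norm (\<iota> (simple_integral X (s n)) - \<iota> (simple_integral X (r n))) \<le>
      2 * L2_dist (simple_value (s n)) f + 2 * L2_dist f g + 2 * L2_dist (simple_value (r n)) g +
      \<bar>(LINT x|lebesgue. simple_value (s n) x) - (LINT x|lebesgue. simple_value (r n) x)\<bar>"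
    using norm_simple_integral_diff_le[OF fin f g] by (intro exI[of _ 0]) simp
qed

text \<open>
  Every sequence admitted in the definition of the Poisson integral is an approximation of \<open>f\<close>, so its
  integrals tend to \<open>Y\<close>. The description determines \<open>Y\<close> only because admitted sequences
  exist, that is, because approximations can be chosen to vanish wherever \<open>f\<close> does.
\<close>

lemma poisson_integral_eq_limit:
  assumes f: "integrable lebesgue f" "square_integrable f"
    and supp: "\<And>x. x \<notin> {a..b} \<Longrightarrow> f x = 0" and "a < b"
    and s: "simple_approximation s f"
    and Y: "(\<lambda>n. \<iota> (simple_integral X (s n))) \<longlonglongrightarrow> Y"
  shows "poisson_integral \<iota> X f = Y"
  unfolding poisson_integral_def
proof (rule the_equality)
  show "\<forall>r. (\<forall>n. is_simple (r n) \<and> {x. simple_value (r n) x \<noteq> 0} \<subseteq> {x. f x \<noteq> 0}) \<longrightarrow>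
      (\<lambda>n. L2_dist (simple_value (r n)) f) \<longlonglongrightarrow> 0 \<longrightarrow> (\<lambda>n. \<iota> (simple_integral X (r n))) \<longlonglongrightarrow> Y"
  proof (intro allI impI)
    fix r :: "nat \<Rightarrow> simple_fun"
    assume "\<forall>n. is_simple (r n) \<and> {x. simple_value (r n) x \<noteq> 0} \<subseteq> {x. f x \<noteq> 0}"
      and "(\<lambda>n. L2_dist (simple_value (r n)) f) \<longlonglongrightarrow> 0"
    then have r: "simple_approximation r f"
      using f supp \<open>a < b\<close> by (intro simple_approximation_of_L2_limit[of f a b]) auto
    obtain Z where Z: "(\<lambda>n. \<iota> (simple_integral X (r n))) \<longlonglongrightarrow> Z"
      using simple_integral_limit_exists[OF f(2) r] by blast
    have "norm (Z - Y) \<le> 2 * L2_dist f f + \<bar>(LINT x|lebesgue. f x) - (LINT x|lebesgue. f x)\<bar>"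
      by (rule norm_simple_integral_limit_diff_le[OF f(2) f(2) r s Z Y])
    then have "Z = Y"
      by (simp add: L2_dist_def)
    then show "(\<lambda>n. \<iota> (simple_integral X (r n))) \<longlonglongrightarrow> Y"
      using Z by simp
  qed
  note Y_limit = this[rule_format]
  obtain r where approx: "simple_approximation r f"
    and r_supp: "\<And>n. {x. simple_value (r n) x \<noteq> 0} \<subseteq> {x. f x \<noteq> 0}"
    using ex_simple_approximation[OF f] by blast
  have r: "\<forall>n. is_simple (r n) \<and> {x. simple_value (r n) x \<noteq> 0} \<subseteq> {x. f x \<noteq> 0}"
      "(\<lambda>n. L2_dist (simple_value (r n)) f) \<longlonglongrightarrow> 0"
    using approx r_supp by (simp_all add: simple_approximation_def)
  have rY: "(\<lambda>n. \<iota> (simple_integral X (r n))) \<longlonglongrightarrow> Y"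
    using r by (intro Y_limit) auto
  show "Z = Y" if "\<forall>r. (\<forall>n. is_simple (r n) \<and> {x. simple_value (r n) x \<noteq> 0} \<subseteq> {x. f x \<noteq> 0}) \<longrightarrow>
      (\<lambda>n. L2_dist (simple_value (r n)) f) \<longlonglongrightarrow> 0 \<longrightarrow> (\<lambda>n. \<iota> (simple_integral X (r n))) \<longlonglongrightarrow> Z" for Z
    using LIMSEQ_unique[OF that[rule_format, OF r[rule_format]] rY] .
qed

end

section \<open>Truncation to growing intervals\<close>

lemma truncation_tendsto:
  assumes f: "integrable lebesgue f" "square_integrable f"
  defines "trunc t \<equiv> \<lambda>x. f x * indicator {- t..t} x"
  shows "integrable lebesgue (trunc t)" and "square_integrable (trunc t)"
    and "((\<lambda>t. LINT x|lebesgue. trunc t x) \<longlongrightarrow> (LINT x|lebesgue. f x)) at_top"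
    and "((\<lambda>t. L2_dist (trunc t) f) \<longlongrightarrow> 0) at_top"
proof -
  show int: "integrable lebesgue (trunc t)" for t
    unfolding trunc_def using f(1) by (intro integrable_real_mult_indicator) auto
  then have tm: "trunc t \<in> borel_measurable lebesgue" for t
    by (simp add: borel_measurable_integrable)
  have fm: "f \<in> borel_measurable lebesgue"
    using f(1) by (simp add: borel_measurable_integrable)
  have f2: "integrable lebesgue (\<lambda>x. (f x)\<^sup>2)"
    using f(2) by (simp add: square_integrable_def)
  have "integrable lebesgue (\<lambda>x. (f x)\<^sup>2 * indicator {- t..t} x)" for t
    using f2 by (intro integrable_real_mult_indicator) auto
  moreover have "(trunc t x)\<^sup>2 = (f x)\<^sup>2 * indicator {- t..t} x" for t x
    by (simp add: trunc_def indicator_def)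
  ultimately show "square_integrable (trunc t)" for t
    using tm by (simp add: square_integrable_def)
  have lim: "((\<lambda>t. trunc t x) \<longlongrightarrow> f x) at_top" for x
  proof (rule tendsto_eventually)
    show "\<forall>\<^sub>F t in at_top. trunc t x = f x"
      using eventually_ge_at_top[of "\<bar>x\<bar>"]
      by eventually_elim (auto simp: trunc_def indicator_def)
  qed
  show "((\<lambda>t. LINT x|lebesgue. trunc t x) \<longlongrightarrow> (LINT x|lebesgue. f x)) at_top"
    by (rule integral_dominated_convergence_at_top[where w = "\<lambda>x. \<bar>f x\<bar>"])
      (use f(1) fm tm lim in \<open>auto simp: trunc_def indicator_def\<close>)
  have "((\<lambda>t. LINT x|lebesgue. (trunc t x - f x)\<^sup>2) \<longlongrightarrow> (LINT x::real|lebesgue. 0)) at_top"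
  proof (rule integral_dominated_convergence_at_top[where w = "\<lambda>x. (f x)\<^sup>2" and
        s = "\<lambda>t x. (trunc t x - f x)\<^sup>2" and f = "\<lambda>x. 0"])
    show "(\<lambda>x. (trunc t x - f x)\<^sup>2) \<in> borel_measurable lebesgue" for t
      using tm fm by measurable
    have "((\<lambda>t. (trunc t x - f x)\<^sup>2) \<longlongrightarrow> 0) at_top" for x
      using lim[of x] by (auto intro!: tendsto_eq_intros)
    then show "AE x in lebesgue. ((\<lambda>t. (trunc t x - f x)\<^sup>2) \<longlongrightarrow> 0) at_top"
      by simp
  qed (use f2 in \<open>auto simp: trunc_def indicator_def\<close>)
  then show "((\<lambda>t. L2_dist (trunc t) f) \<longlongrightarrow> 0) at_top"
    unfolding L2_dist_def by (auto intro!: tendsto_eq_intros)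
qed

theorem theorem5p4:
  fixes M :: "'h::complex_hilbert oper set"
    and \<phi> :: "'h oper \<Rightarrow> complex"
    and \<iota> :: "'h oper \<Rightarrow> 'l::complex_hilbert"
    and L :: "'l set"
    and X :: "real set \<Rightarrow> 'h oper"
    and f :: "real \<Rightarrow> real"
  assumes "w_star_probability_space M \<phi>"
    and "is_L2_completion M \<phi> \<iota> L"
    and "free_poisson_random_measure M \<phi> X"
    and "integrable lebesgue f"
    and "square_integrable f"
  shows "\<exists>Y\<in>L. ((\<lambda>t. truncated_poisson_integral \<iota> X f t) \<longlongrightarrow> Y) at_top"
proof -
  interpret w_star_probability_space M \<phi> by fact
  interpret free_poisson_integration M \<phi> X \<iota> L
    by unfold_locales fact+
  note f = \<open>integrable lebesgue f\<close> \<open>square_integrable f\<close>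
  obtain s where s: "simple_approximation s f"
    by (rule ex_simple_approximation[OF f])
  obtain Y where Y: "Y \<in> L" "(\<lambda>n. \<iota> (simple_integral X (s n))) \<longlonglongrightarrow> Y"
    using simple_integral_limit_exists[OF f(2) s] by blast
  define trunc where "trunc t x = f x * indicator {- t..t} x" for t x
  note trunc = truncation_tendsto[OF f, folded trunc_def]
  have bound: "norm (truncated_poisson_integral \<iota> X f t - Y) \<le>
      2 * L2_dist (trunc t) f + \<bar>(LINT x|lebesgue. trunc t x) - (LINT x|lebesgue. f x)\<bar>"
    if "0 < t" for t
  proof -
    obtain r where r: "simple_approximation r (trunc t)"
      by (rule ex_simple_approximation[OF trunc(1,2)])
    obtain Z where Z: "(\<lambda>n. \<iota> (simple_integral X (r n))) \<longlonglongrightarrow> Z"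
      using simple_integral_limit_exists[OF trunc(2) r] by blast
    have "poisson_integral \<iota> X (trunc t) = Z"
      using that by (intro poisson_integral_eq_limit[OF trunc(1,2) _ _ r Z, where a = "- t" and b = t])
        (auto simp: trunc_def)
    then have "truncated_poisson_integral \<iota> X f t = Z"
      by (simp add: truncated_poisson_integral_def trunc_def[abs_def])
    then show ?thesis
      using norm_simple_integral_limit_diff_le[OF trunc(2) f(2) r s Z Y(2)] by simp
  qed
  have "((\<lambda>t. 2 * L2_dist (trunc t) f +
      \<bar>(LINT x|lebesgue. trunc t x) - (LINT x|lebesgue. f x)\<bar>) \<longlongrightarrow> 0) at_top"
    using trunc(3,4) by (auto intro!: tendsto_eq_intros)
  moreover have "\<forall>\<^sub>F t in at_top. norm (truncated_poisson_integral \<iota> X f t - Y) \<le>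
      2 * L2_dist (trunc t) f + \<bar>(LINT x|lebesgue. trunc t x) - (LINT x|lebesgue. f x)\<bar>"
    using eventually_gt_at_top[of 0] by (rule eventually_mono) (rule bound)
  ultimately have "((\<lambda>t. truncated_poisson_integral \<iota> X f t - Y) \<longlongrightarrow> 0) at_top"
    by (rule Lim_null_comparison[rotated])
  then show ?thesis
    using Y(1) LIM_zero_cancel by blast
qed

end
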